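(* Let $(X,E)$ be an undirected simple graph with finite vertex set $X$, let $Y$ be a finite set and let $F:X\to 2^Y$ be a set-valued mapping with $G(F)\ne\emptyset$. For any execution of Calculation Method 1 applied to $F$, with largest occurring index $i^{max}_1$, the following statements are equivalent: (i) $F$ admits a disparate selection. (ii) Calculation Method 1 does not stop at Step 5. (iii) Calculation Method 1 stops at Step 3. (iv) $F^{i^{max}_1}$ is disparate. (v) $G(F^{i^{max}_1})\ne\emptyset$ and $F^*=F^{i^{max}_1}$.
   Context: Setting. $(X,E)$ is an undirected simple graph with finite vertex set $X$, $Y$ is a finite set, $F:X\to 2^Y$ is a set-valued mapping (empty images are allowed). $\sharp$ denotes cardinality; $\subset$ allows equality. $G(F)=\{(x,y)\in X\times Y\mid y\in F(x)\}$ is the graph of $F$; $F_{|W}$ is the restriction of $F$ to $W\subset X$. A submapping of $F$ is a set-valued mapping $F'$ on the same domain with $G(F')\subset G(F)$. A selection of $F$ is a map $s:X\to Y$ with $s(x)\in F(x)$ for all $x\in X$. Disparate. Points $(x,y),(x',y')\in X\times Y$ are disparate if $(x,y)\ne(x',y')$ and ($y=y'$ implies $\{x,x'\}\notin E$). A set $A\subset X\times Y$ is disparate if any two distinct points of $A$ are disparate. A selection $s$ is disparate if $G(s)=\{(x,s(x))\mid x\in X\}$ is a disparate set. For $A\subset X\times Y$: $hull(A)=\{a\in X\times Y\mid$ there is $a'\in A$ such that $a,a'$ are not disparate$\}$ and $compl(A)=\{a\in X\times Y\mid a,a'$ are disparate for every $a'\in A\}$. Complement mapping. For $W\subset X$ and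 $Z\subset W\times Y$, $F_{W,Z}:X\setminus W\to 2^Y$ is defined by $G(F_{W,Z})=G(F_{|X\setminus W})\cap compl(Z)$. Convention. For a mapping defined on a subset $X'\subset X$, all notions are understood with $X'$ and the subgraph of $(X,E)$ induced by $X'$ in place of $X$ and $(X,E)$. Collections. A collection of $F$ is a family $\mathcal H=(A_V)$ indexed by the nonempty sets $V\subset X$, with $A_V\subset G(F_{|V})$. It is a Hall collection if every $A_V$ is disparate and $\sharp A_V\ge\sharp V$. For $W\subset X$, $\mathcal H_{|W}$ is the family of the $A_V$ with $\emptyset\ne V\subset W$ (a collection of $F_{|W}$), and $\mathcal H_W$ is the family, indexed by the nonempty $V\subset X\setminus W$, of the sets $A_{W\cup V}\cap compl(\bigcup_{A\in\mathcal H_{|W}}A)\cap(V\times Y)$ (a collection of $F_{|X\setminus W}$). For nonempty $W$, $F^{\mathcal H_W}$ is the submapping of $F_{|W}$ with graph $G(F_{|W})\cap compl(\bigcup_{A\in\mathcal H_W}A)$. For nonempty $W$, $\mathcal H$ is $W$-distributed if for every nonempty $V\subset X\setminus W$, $$\sharp\Bigl(A_{W\cup V}\cap\bigl((W\times Y)\cup(hull(\textstyle\bigcup_{A\in\mathcal H_{|W}}A)\cap(V\times Y))\bigr)\Bigr)\le\sharp W .$$ Cascades. For a tuple $(W_1,\dots,W_k)$, $k\ge1$, of subsets of $W_0=X$ put $W_0^c=W_0$ and, for $i=1,\dots,k$, $W_i^c=W_{i-1}\setminus W_i$ if $W_i\subset W_{i-1}$, and $W_i^c=W_{i-1}^c\setminus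 W_i$ otherwise. The tuple is a cascade in $X$ if $W_i\subset W_{i-1}$ or $W_i\subset W_{i-1}^c$ for $i=1,\dots,k$. Put $pre(i)=W_{i-1}$ if $W_i\subset W_{i-1}$ and $pre(i)=W_{i-1}^c$ if $W_i\subset W_{i-1}^c$. Given a collection $\mathcal H$ of $F$ and a cascade, put $\mathcal H(W_1,\dots,W_0)=\mathcal H$, $F(W_1,\dots,W_0)=F$ and inductively for $i=1,\dots,k-1$, writing $\mathcal H'=\mathcal H(W_1,\dots,W_{i-1})$, $F'=F(W_1,\dots,W_{i-1})$ and $\tilde F=F'^{\,\mathcal H'_{W_i}}$: if $W_{i+1}\subset W_i$, then $\mathcal H(W_1,\dots,W_i)=\mathcal H'_{|W_i}$ and $F(W_1,\dots,W_i)=\tilde F$; if $W_{i+1}\subset W_i^c$, then $\mathcal H(W_1,\dots,W_i)=\mathcal H'_{W_i}$ and $F(W_1,\dots,W_i)=F'_{W_i,G(\tilde F)}$. Here $F(W_1,\dots,W_{i-1})$ is a mapping on $pre(i)$ and $\mathcal H(W_1,\dots,W_{i-1})$ is a collection of it. Generalized Hall condition (recursion on $\sharp X\ge 1$). If $\sharp X=1$, $F$ satisfies it if $G(F)\ne\emptyset$. Let $\sharp X>1$ and suppose the condition is defined for mappings on smaller vertex sets. - A nonempty $W\subset X$ is a generalized critical set of $F$ if there is $(x,y)\in(X\setminus W)\times Y$ such that $(F_{\{x\},\{(x,y)\}})_{|W}$ does not satisfy the generalized Hall condition. It is minimal if no proper subset of $W$ is a generalized critical set of $F$. - For a Hall collection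 $\mathcal H$ of $F$, a cascade $(W_1,\dots,W_k)$ in $X$ is a primitive $(F,\mathcal H)$-critical cascade if $W_i$ is a minimal generalized critical set of $F(W_1,\dots,W_{i-1})$ for $i=1,\dots,k$. - A Hall collection $\mathcal H$ of $F$ is distributed if for each primitive $(F,\mathcal H)$-critical cascade $(W_1,\dots,W_k)$ in $X$ the collection $\mathcal H(W_1,\dots,W_{i-1})$ of $F(W_1,\dots,W_{i-1})$ is $W_i$-distributed for $i=1,\dots,k$. - $F$ satisfies the generalized Hall condition if $F$ admits a distributed Hall collection. Disparate kernel. $F^*$ is the submapping of $F$ with $F^*(x)=\{y\in F(x)\mid$ there is a disparate selection $s$ of $F$ with $s(x)=y\}$. $F$ is called disparate if $G(F)\ne\emptyset$ and $F^*=F$. Elimination. For nonempty $W\subset X$, $elim_F(W)$ is the set of all $(x,y)\in G(F_{|X\setminus W})$ such that $(F_{\{x\},\{(x,y)\}})_{|W}$ does not satisfy the generalized Hall condition. A nonempty $W\subset X$ is an elimination set of $F$ if $elim_F(W)\ne\emptyset$. Calculation Method 1. Step 1: set $F^1=F$ and $i=1$. Step 2: choose an elimination set $W\subset X$ of $F^i$. Step 3: if $F^i$ does not admit an elimination set, STOP; otherwise continue. Step 4: define $F^{i+1}$ by $G(F^{i+1})=G(F^i)\setminus elim_{F^i}(W)$. Step 5: if $F^{i+1}(x)=\emptyset$ for some $x\in X$, STOP; otherwise continue. Step 6: increase $i$ to $i+1$ and continue with Step 2. The choices in Step 2 are arbitrary. The method always terminates after finitely many steps; $i^{max}_1$ denotes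 the largest index of a mapping $F^{j}$ occurring: $i^{max}_1$ is the current value of $i$ if the method stops at Step 3, and the current value of $i+1$ if it stops at Step 5. *)

theory Defs
  imports Main
begin

text \<open>
  Graphs are given by a vertex set \<open>X\<close> and a set \<open>E\<close> of edges, each edge being a two-element set.
  A set-valued mapping on a domain \<open>D\<close> is a function \<open>F :: 'v \<Rightarrow> 'y set\<close> of which only the values
  on \<open>D\<close> matter, so the restriction \<open>F|D'\<close> is \<open>F\<close> itself, read on \<open>D'\<close>. Its graph is
  \<open>Sigma D F\<close>. The edge set \<open>E\<close> is not changed when passing to an induced subgraph: it is only ever
  tested on pairs of vertices of the current domain.
\<close>

definition simple_graph :: "'v set \<Rightarrow> 'v set set \<Rightarrow> bool" where
  "simple_graph X E \<longleftrightarrow> (\<forall>e\<in>E. e \<subseteq> X \<and> card e = 2)"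

definition map_of_graph :: "('v \<times> 'y) set \<Rightarrow> 'v \<Rightarrow> 'y set" where
  "map_of_graph A x = {y. (x, y) \<in> A}"


subsection \<open>Disparate points, sets, selections\<close>

definition disparate :: "'v set set \<Rightarrow> 'v \<times> 'y \<Rightarrow> 'v \<times> 'y \<Rightarrow> bool" where
  "disparate E a a' \<longleftrightarrow> a \<noteq> a' \<and> (snd a = snd a' \<longrightarrow> {fst a, fst a'} \<notin> E)"

definition disparate_set :: "'v set set \<Rightarrow> ('v \<times> 'y) set \<Rightarrow> bool" where
  "disparate_set E A \<longleftrightarrow> (\<forall>a\<in>A. \<forall>a'\<in>A. a \<noteq> a' \<longrightarrow> disparate E a a')"

definition selection :: "'v set \<Rightarrow> ('v \<Rightarrow> 'y set) \<Rightarrow> ('v \<Rightarrow> 'y) \<Rightarrow> bool" where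
  "selection X F s \<longleftrightarrow> (\<forall>x\<in>X. s x \<in> F x)"

definition disparate_selection ::
  "'v set set \<Rightarrow> 'v set \<Rightarrow> ('v \<Rightarrow> 'y set) \<Rightarrow> ('v \<Rightarrow> 'y) \<Rightarrow> bool" where
  "disparate_selection E X F s \<longleftrightarrow> selection X F s \<and> disparate_set E {(x, s x) | x. x \<in> X}"

definition hull_set :: "'v set set \<Rightarrow> 'y set \<Rightarrow> 'v set \<Rightarrow> ('v \<times> 'y) set \<Rightarrow> ('v \<times> 'y) set" where
  "hull_set E Y X A = {a \<in> X \<times> Y. \<exists>a'\<in>A. \<not> disparate E a a'}"

definition compl_set :: "'v set set \<Rightarrow> 'y set \<Rightarrow> 'v set \<Rightarrow> ('v \<times> 'y) set \<Rightarrow> ('v \<times> 'y) set" where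
  "compl_set E Y X A = {a \<in> X \<times> Y. \<forall>a'\<in>A. disparate E a a'}"

text \<open>The complement mapping \<open>F\<^bsub>W,Z\<^esub>\<close>, a mapping on \<open>X - W\<close>.\<close>

definition compl_map ::
  "'v set set \<Rightarrow> 'y set \<Rightarrow> 'v set \<Rightarrow> ('v \<Rightarrow> 'y set) \<Rightarrow> 'v set \<Rightarrow> ('v \<times> 'y) set \<Rightarrow> 'v \<Rightarrow> 'y set" where
  "compl_map E Y X F W Z = map_of_graph (Sigma (X - W) F \<inter> compl_set E Y X Z)"


subsection \<open>Collections\<close>

text \<open>
  A collection of a mapping on \<open>X\<close> is a function \<open>H :: 'v set \<Rightarrow> ('v \<times> 'y) set\<close> of which only the
  values on nonempty subsets of \<open>X\<close> matter. Thus the restricted collection \<open>H|W\<close> is \<open>H\<close> itself,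
  read on the nonempty subsets of \<open>W\<close>.
\<close>

definition collection :: "'v set \<Rightarrow> ('v \<Rightarrow> 'y set) \<Rightarrow> ('v set \<Rightarrow> ('v \<times> 'y) set) \<Rightarrow> bool" where
  "collection X F H \<longleftrightarrow> (\<forall>V. V \<noteq> {} \<and> V \<subseteq> X \<longrightarrow> H V \<subseteq> Sigma V F)"

definition hall_collection ::
  "'v set set \<Rightarrow> 'v set \<Rightarrow> ('v \<Rightarrow> 'y set) \<Rightarrow> ('v set \<Rightarrow> ('v \<times> 'y) set) \<Rightarrow> bool" where
  "hall_collection E X F H \<longleftrightarrow> collection X F H \<and>
     (\<forall>V. V \<noteq> {} \<and> V \<subseteq> X \<longrightarrow> disparate_set E (H V) \<and> card (H V) \<ge> card V)"

text \<open>The union of all members of a collection with index sets in \<open>D\<close>.\<close>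

definition coll_union :: "'v set \<Rightarrow> ('v set \<Rightarrow> ('v \<times> 'y) set) \<Rightarrow> ('v \<times> 'y) set" where
  "coll_union D H = (\<Union>V\<in>{V. V \<noteq> {} \<and> V \<subseteq> D}. H V)"

text \<open>The collection \<open>H\<^sub>W\<close>, indexed by the nonempty subsets of \<open>X - W\<close>.\<close>

definition coll_compl ::
  "'v set set \<Rightarrow> 'y set \<Rightarrow> 'v set \<Rightarrow> ('v set \<Rightarrow> ('v \<times> 'y) set) \<Rightarrow> 'v set \<Rightarrow> 'v set \<Rightarrow> ('v \<times> 'y) set" where
  "coll_compl E Y X H W V = H (W \<union> V) \<inter> compl_set E Y X (coll_union W H) \<inter> (V \<times> Y)"

text \<open>The submapping of \<open>F|W\<close> denoted by \<open>F\<close> with superscript \<open>H\<^sub>W\<close>.\<close>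

definition coll_submap ::
  "'v set set \<Rightarrow> 'y set \<Rightarrow> 'v set \<Rightarrow> ('v \<Rightarrow> 'y set) \<Rightarrow> ('v set \<Rightarrow> ('v \<times> 'y) set) \<Rightarrow> 'v set \<Rightarrow> 'v \<Rightarrow> 'y set" where
  "coll_submap E Y X F H W =
     map_of_graph (Sigma W F \<inter> compl_set E Y X (coll_union (X - W) (coll_compl E Y X H W)))"

definition set_distributed ::
  "'v set set \<Rightarrow> 'y set \<Rightarrow> 'v set \<Rightarrow> ('v set \<Rightarrow> ('v \<times> 'y) set) \<Rightarrow> 'v set \<Rightarrow> bool" where
  "set_distributed E Y X H W \<longleftrightarrow>
     (\<forall>V. V \<noteq> {} \<and> V \<subseteq> X - W \<longrightarrow>
        card (H (W \<union> V) \<inter> (W \<times> Y \<union> hull_set E Y X (coll_union W H) \<inter> (V \<times> Y))) \<le> card W)"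


subsection \<open>Cascades\<close>

text \<open>
  A tuple \<open>(W\<^sub>1, \<dots>, W\<^sub>k)\<close> of subsets of \<open>X\<close> is given by \<open>k\<close> and a function \<open>W :: nat \<Rightarrow> 'v set\<close> with
  \<open>W 0 = X\<close>; the values \<open>W i\<close> for \<open>i > k\<close> are irrelevant.
\<close>

fun casc_c :: "(nat \<Rightarrow> 'v set) \<Rightarrow> nat \<Rightarrow> 'v set" where
  "casc_c W 0 = W 0"
| "casc_c W (Suc i) = (if W (Suc i) \<subseteq> W i then W i - W (Suc i) else casc_c W i - W (Suc i))"

definition cascade :: "'v set \<Rightarrow> (nat \<Rightarrow> 'v set) \<Rightarrow> nat \<Rightarrow> bool" where
  "cascade X W k \<longleftrightarrow> 1 \<le> k \<and> W 0 = X \<and>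
     (\<forall>i\<in>{1..k}. W i \<subseteq> W (i - 1) \<or> W i \<subseteq> casc_c W (i - 1))"

definition casc_pre :: "(nat \<Rightarrow> 'v set) \<Rightarrow> nat \<Rightarrow> 'v set" where
  "casc_pre W i = (if W i \<subseteq> W (i - 1) then W (i - 1) else casc_c W (i - 1))"

text \<open>
  \<open>casc_coll E Y W H i\<close> and \<open>casc_map E Y W F H i\<close> are \<open>H(W\<^sub>1, \<dots>, W\<^sub>i)\<close> and \<open>F(W\<^sub>1, \<dots>, W\<^sub>i)\<close>; they
  live on \<open>casc_pre W (i + 1)\<close> and depend on \<open>W\<^sub>1, \<dots>, W\<^sub>i\<^sub>+\<^sub>1\<close>. For \<open>W (i + 1) \<subseteq> W i\<close> the collection
  is restricted to \<open>W i\<close>, which does not change the underlying function. The two cases only overlap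
  for \<open>W (i + 1) = {}\<close>, which does not occur in critical cascades.
\<close>

fun casc_coll ::
  "'v set set \<Rightarrow> 'y set \<Rightarrow> (nat \<Rightarrow> 'v set) \<Rightarrow> ('v set \<Rightarrow> ('v \<times> 'y) set) \<Rightarrow> nat \<Rightarrow> 'v set \<Rightarrow> ('v \<times> 'y) set" where
  "casc_coll E Y W H 0 = H"
| "casc_coll E Y W H (Suc j) =
     (let i = Suc j; H' = casc_coll E Y W H j in
      if W (Suc i) \<subseteq> W i then H'
      else coll_compl E Y (casc_pre W i) H' (W i))"

fun casc_map ::
  "'v set set \<Rightarrow> 'y set \<Rightarrow> (nat \<Rightarrow> 'v set) \<Rightarrow> ('v \<Rightarrow> 'y set) \<Rightarrow> ('v set \<Rightarrow> ('v \<times> 'y) set) \<Rightarrow> nat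
     \<Rightarrow> 'v \<Rightarrow> 'y set" where
  "casc_map E Y W F H 0 = F"
| "casc_map E Y W F H (Suc j) =
     (let i = Suc j; H' = casc_coll E Y W H j; F' = casc_map E Y W F H j;
          F'' = coll_submap E Y (casc_pre W i) F' H' (W i) in
      if W (Suc i) \<subseteq> W i then F''
      else compl_map E Y (casc_pre W i) F' (W i) (Sigma (W i) F''))"


subsection \<open>The generalized Hall condition\<close>

text \<open>
  The condition is defined by recursion on the number of vertices. In the following four definitions
  the parameter \<open>P\<close> stands for the generalized Hall condition itself (\<open>P W K\<close>: the mapping \<open>K\<close> on
  \<open>W\<close> satisfies it); it is only evaluated on proper subsets of the vertex set under consideration.
\<close>

definition gen_critical ::
  "('v set \<Rightarrow> ('v \<Rightarrow> 'y set) \<Rightarrow> bool) \<Rightarrow> 'v set set \<Rightarrow> 'y set \<Rightarrow> 'v set \<Rightarrow> ('v \<Rightarrow> 'y set) \<Rightarrow> 'v set \<Rightarrow> bool" where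
  "gen_critical P E Y X F W \<longleftrightarrow> W \<noteq> {} \<and> W \<subseteq> X \<and>
     (\<exists>x y. (x, y) \<in> (X - W) \<times> Y \<and> \<not> P W (compl_map E Y X F {x} {(x, y)}))"

definition minimal_gen_critical ::
  "('v set \<Rightarrow> ('v \<Rightarrow> 'y set) \<Rightarrow> bool) \<Rightarrow> 'v set set \<Rightarrow> 'y set \<Rightarrow> 'v set \<Rightarrow> ('v \<Rightarrow> 'y set) \<Rightarrow> 'v set \<Rightarrow> bool" where
  "minimal_gen_critical P E Y X F W \<longleftrightarrow>
     gen_critical P E Y X F W \<and> (\<forall>W'. W' \<subset> W \<longrightarrow> \<not> gen_critical P E Y X F W')"

definition primitive_critical_cascade ::
  "('v set \<Rightarrow> ('v \<Rightarrow> 'y set) \<Rightarrow> bool) \<Rightarrow> 'v set set \<Rightarrow> 'y set \<Rightarrow> 'v set \<Rightarrow> ('v \<Rightarrow> 'y set)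
     \<Rightarrow> ('v set \<Rightarrow> ('v \<times> 'y) set) \<Rightarrow> (nat \<Rightarrow> 'v set) \<Rightarrow> nat \<Rightarrow> bool" where
  "primitive_critical_cascade P E Y X F H W k \<longleftrightarrow> cascade X W k \<and>
     (\<forall>i\<in>{1..k}. minimal_gen_critical P E Y (casc_pre W i) (casc_map E Y W F H (i - 1)) (W i))"

definition distributed ::
  "('v set \<Rightarrow> ('v \<Rightarrow> 'y set) \<Rightarrow> bool) \<Rightarrow> 'v set set \<Rightarrow> 'y set \<Rightarrow> 'v set \<Rightarrow> ('v \<Rightarrow> 'y set)
     \<Rightarrow> ('v set \<Rightarrow> ('v \<times> 'y) set) \<Rightarrow> bool" where
  "distributed P E Y X F H \<longleftrightarrow>
     (\<forall>W k. primitive_critical_cascade P E Y X F H W k \<longrightarrow>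
        (\<forall>i\<in>{1..k}. set_distributed E Y (casc_pre W i) (casc_coll E Y W H (i - 1)) (W i)))"

lemma gen_critical_cong:
  assumes "\<And>V K. V \<subset> X \<Longrightarrow> P V K = Q V K"
  shows "gen_critical P E Y X F W = gen_critical Q E Y X F W"
proof -
  have "W \<subset> X" if "W \<subseteq> X" "x \<in> X - W" for x
    using that by auto
  then show ?thesis
    using assms unfolding gen_critical_def by (metis mem_Sigma_iff)
qed

lemma casc_subset:
  assumes "cascade X W k" "i \<le> k"
  shows "W i \<subseteq> X \<and> casc_c W i \<subseteq> X"
  using assms(2)
proof (induction i)
  case 0
  then show ?case using assms(1) by (simp add: cascade_def)
next
  case (Suc i)
  then have "W (Suc i) \<subseteq> W i \<or> W (Suc i) \<subseteq> casc_c W i"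
    using assms(1) by (fastforce simp: cascade_def)
  with Suc show ?case by auto
qed

lemma casc_pre_subset:
  assumes "cascade X W k" "i \<in> {1..k}"
  shows "casc_pre W i \<subseteq> X"
proof -
  have "i - 1 \<le> k"
    using assms(2) by auto
  then show ?thesis
    using casc_subset[OF assms(1)] by (simp add: casc_pre_def)
qed

lemma distributed_cong [fundef_cong]:
  assumes "E = E'" "Y = Y'" "X = X'" "F = F'" "H = H'"
    and "\<And>V K. V \<subset> X' \<Longrightarrow> P V K = Q V K"
  shows "distributed P E Y X F H = distributed Q E' Y' X' F' H'"
proof -
  have "gen_critical P E Y D K V = gen_critical Q E Y D K V" if "D \<subseteq> X" for D K V
    using that assms by (intro gen_critical_cong) auto
  then have minimal: "minimal_gen_critical P E Y D K V = minimal_gen_critical Q E Y D K V"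
    if "D \<subseteq> X" for D K V
    using that by (simp add: minimal_gen_critical_def)
  have "primitive_critical_cascade P E Y X F H W k = primitive_critical_cascade Q E Y X F H W k"
    for W k
    unfolding primitive_critical_cascade_def
    by (intro conj_cong ball_cong refl minimal casc_pre_subset)
  then show ?thesis
    using assms by (simp add: distributed_def)
qed

text \<open>The condition is only of interest for finite nonempty \<open>X\<close>; other \<open>X\<close> get a dummy value.\<close>

function gen_hall :: "'v set set \<Rightarrow> 'y set \<Rightarrow> 'v set \<Rightarrow> ('v \<Rightarrow> 'y set) \<Rightarrow> bool" where
  "gen_hall E Y X F =
     (if infinite X \<or> X = {} then False
      else if card X = 1 then Sigma X F \<noteq> {}
      else \<exists>H. hall_collection E X F H \<and> distributed (\<lambda>W K. gen_hall E Y W K) E Y X F H)"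
  by pat_completeness auto
termination
  by (relation "measure (\<lambda>(E, Y, X, F). card X)") (auto intro: psubset_card_mono)

declare gen_hall.simps [simp del]


subsection \<open>Disparate kernel and elimination\<close>

definition disparate_kernel :: "'v set set \<Rightarrow> 'v set \<Rightarrow> ('v \<Rightarrow> 'y set) \<Rightarrow> 'v \<Rightarrow> 'y set" where
  "disparate_kernel E X F x = {y \<in> F x. \<exists>s. disparate_selection E X F s \<and> s x = y}"

definition disparate_map :: "'v set set \<Rightarrow> 'v set \<Rightarrow> ('v \<Rightarrow> 'y set) \<Rightarrow> bool" where
  "disparate_map E X F \<longleftrightarrow> Sigma X F \<noteq> {} \<and> (\<forall>x\<in>X. disparate_kernel E X F x = F x)"

definition elim ::
  "'v set set \<Rightarrow> 'y set \<Rightarrow> 'v set \<Rightarrow> ('v \<Rightarrow> 'y set) \<Rightarrow> 'v set \<Rightarrow> ('v \<times> 'y) set" where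
  "elim E Y X F W =
     {(x, y) \<in> Sigma (X - W) F. \<not> gen_hall E Y W (compl_map E Y X F {x} {(x, y)})}"

definition elimination_set ::
  "'v set set \<Rightarrow> 'y set \<Rightarrow> 'v set \<Rightarrow> ('v \<Rightarrow> 'y set) \<Rightarrow> 'v set \<Rightarrow> bool" where
  "elimination_set E Y X F W \<longleftrightarrow> W \<noteq> {} \<and> W \<subseteq> X \<and> elim E Y X F W \<noteq> {}"


subsection \<open>Calculation Method 1\<close>

text \<open>
  An execution is described by the sequence \<open>Fs\<close> of mappings and the sequence \<open>Ws\<close> of choices made
  in Step 2; \<open>Fs i\<close> and \<open>Ws i\<close> are only constrained as far as the method produces them.
  \<open>cm1_step2 E Y X Fs i\<close> says that Step 2 is entered with the value \<open>i\<close> of the running index. That an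
  execution is finite is not part of the definition.
\<close>

inductive cm1_step2 ::
  "'v set set \<Rightarrow> 'y set \<Rightarrow> 'v set \<Rightarrow> (nat \<Rightarrow> 'v \<Rightarrow> 'y set) \<Rightarrow> nat \<Rightarrow> bool"
  for E Y X Fs where
  "cm1_step2 E Y X Fs 1"
| "cm1_step2 E Y X Fs (Suc i)"
  if "cm1_step2 E Y X Fs i" "\<exists>W. elimination_set E Y X (Fs i) W" "\<forall>x\<in>X. Fs (Suc i) x \<noteq> {}"

definition cm1_execution ::
  "'v set set \<Rightarrow> 'y set \<Rightarrow> 'v set \<Rightarrow> ('v \<Rightarrow> 'y set) \<Rightarrow> (nat \<Rightarrow> 'v \<Rightarrow> 'y set) \<Rightarrow> (nat \<Rightarrow> 'v set) \<Rightarrow> bool" where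
  "cm1_execution E Y X F Fs Ws \<longleftrightarrow> Fs 1 = F \<and>
     (\<forall>i. cm1_step2 E Y X Fs i \<and> (\<exists>W. elimination_set E Y X (Fs i) W) \<longrightarrow>
        elimination_set E Y X (Fs i) (Ws i) \<and>
        Sigma X (Fs (Suc i)) = Sigma X (Fs i) - elim E Y X (Fs i) (Ws i))"

definition cm1_stops_at_step3 ::
  "'v set set \<Rightarrow> 'y set \<Rightarrow> 'v set \<Rightarrow> (nat \<Rightarrow> 'v \<Rightarrow> 'y set) \<Rightarrow> bool" where
  "cm1_stops_at_step3 E Y X Fs \<longleftrightarrow>
     (\<exists>i. cm1_step2 E Y X Fs i \<and> \<not> (\<exists>W. elimination_set E Y X (Fs i) W))"

definition cm1_stops_at_step5 ::
  "'v set set \<Rightarrow> 'y set \<Rightarrow> 'v set \<Rightarrow> (nat \<Rightarrow> 'v \<Rightarrow> 'y set) \<Rightarrow> bool" where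
  "cm1_stops_at_step5 E Y X Fs \<longleftrightarrow>
     (\<exists>i. cm1_step2 E Y X Fs i \<and> (\<exists>W. elimination_set E Y X (Fs i) W) \<and>
        (\<exists>x\<in>X. Fs (Suc i) x = {}))"

text \<open>\<open>F\<^sup>j\<close> occurs if \<open>j = 1\<close> or if it is produced in Step 4.\<close>

definition cm1_occurs ::
  "'v set set \<Rightarrow> 'y set \<Rightarrow> 'v set \<Rightarrow> (nat \<Rightarrow> 'v \<Rightarrow> 'y set) \<Rightarrow> nat \<Rightarrow> bool" where
  "cm1_occurs E Y X Fs j \<longleftrightarrow> j = 1 \<or>
     (\<exists>i. j = Suc i \<and> cm1_step2 E Y X Fs i \<and> (\<exists>W. elimination_set E Y X (Fs i) W))"

definition cm1_imax :: "'v set set \<Rightarrow> 'y set \<Rightarrow> 'v set \<Rightarrow> (nat \<Rightarrow> 'v \<Rightarrow> 'y set) \<Rightarrow> nat" where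
  "cm1_imax E Y X Fs = Max {j. cm1_occurs E Y X Fs j}"

end

theory Submission
  imports Defs
begin

text \<open>
  The heart of the matter is that, for finite nonempty \<open>X\<close>, the generalized Hall condition is
  equivalent to the existence of a disparate selection.

  A disparate selection \<open>s\<close> yields the Hall collection that assigns to \<open>V\<close> the graph of \<open>s\<close> on \<open>V\<close>.
  This form is preserved by all the collections derived from it along a cascade, and such a
  collection is trivially \<open>W\<close>-distributed, whether or not \<open>W\<close> is critical
  (\<open>gen_hall_if_disparate_selection\<close>).

  Conversely, let \<open>H\<close> be a distributed Hall collection of \<open>F\<close> and argue by induction on the number of
  vertices. If \<open>F\<close> has no generalized critical set, take any point \<open>(x, y)\<close> of its graph: the rest
  \<open>X - {x}\<close>, if nonempty, is not critical, so by induction the points disparate from \<open>(x, y)\<close> admit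
  a disparate selection over \<open>X - {x}\<close>. Otherwise take a minimal critical set \<open>W\<close>. Being
  \<open>W\<close>-distributed ensures that the collection \<open>H\<^sub>W\<close> still satisfies Hall's inequalities, so \<open>H|W\<close>
  and \<open>H\<^sub>W\<close> are Hall collections of a mapping on \<open>W\<close> and a mapping on \<open>X - W\<close> such that every point
  of the graph of the one is disparate from every point of the graph of the other. They are
  distributed again, because prefixing \<open>W\<close> to a primitive critical cascade of either of them gives
  one of \<open>H\<close> (\<open>distributed_descend\<close>). The two selections obtained by induction fit together
  (\<open>disparate_selection_if_gen_hall\<close>).

  Consequently a point in \<open>elim\<close> lies on no disparate selection, so every mapping occurring in the
  calculation has the same disparate selections as \<open>F\<close>; and if no elimination set is left, every
  point of the graph lies on a disparate selection. Since the graphs shrink strictly, the calculation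
  ends, either in this situation or with an empty image.
\<close>

section \<open>Disparate selections\<close>

lemma disparate_sym: "disparate E a b \<longleftrightarrow> disparate E b a"
  unfolding disparate_def by (auto simp: insert_commute)

lemma Sigma_map_of_graph: "A \<subseteq> D \<times> UNIV \<Longrightarrow> Sigma D (map_of_graph A) = A"
  by (auto simp: map_of_graph_def)

lemma Sigma_compl_map:
  "Sigma (X - W) (compl_map E Y X F W Z) = Sigma (X - W) F \<inter> compl_set E Y X Z"
  unfolding compl_map_def by (rule Sigma_map_of_graph) auto

lemma Sigma_coll_submap:
  "Sigma W (coll_submap E Y X F H W) =
     Sigma W F \<inter> compl_set E Y X (coll_union (X - W) (coll_compl E Y X H W))"
  unfolding coll_submap_def by (rule Sigma_map_of_graph) auto

lemma disparate_selection_iff: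
  "disparate_selection E X F s \<longleftrightarrow> (\<forall>x\<in>X. s x \<in> F x) \<and>
     (\<forall>x\<in>X. \<forall>x'\<in>X. x \<noteq> x' \<longrightarrow> disparate E (x, s x) (x', s x'))"
  unfolding disparate_selection_def selection_def disparate_set_def by auto

lemma disparate_selection_union:
  assumes s: "disparate_selection E W F1 s" and t: "disparate_selection E (X - W) F2 t"
    and "W \<subseteq> X"
    and F1: "Sigma W F1 \<subseteq> Sigma X F" and F2: "Sigma (X - W) F2 \<subseteq> Sigma X F"
    and disp: "\<And>a b. a \<in> Sigma W F1 \<Longrightarrow> b \<in> Sigma (X - W) F2 \<Longrightarrow> disparate E a b"
  shows "disparate_selection E X F (\<lambda>x. if x \<in> W then s x else t x)"
proof -
  have s': "(x, s x) \<in> Sigma W F1" if "x \<in> W" for x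
    using s that by (auto simp: disparate_selection_iff)
  have t': "(x, t x) \<in> Sigma (X - W) F2" if "x \<in> X - W" for x
    using t that by (auto simp: disparate_selection_iff)
  show ?thesis
    unfolding disparate_selection_iff
  proof (intro conjI ballI impI)
    fix x assume "x \<in> X"
    then show "(if x \<in> W then s x else t x) \<in> F x"
      using subsetD[OF F1 s'[of x]] subsetD[OF F2 t'[of x]] by simp
  next
    fix x x' assume x: "x \<in> X" "x' \<in> X" "x \<noteq> x'"
    show "disparate E (x, if x \<in> W then s x else t x) (x', if x' \<in> W then s x' else t x')"
    proof (cases "x \<in> W"; cases "x' \<in> W")
      assume "x \<in> W" "x' \<in> W"
      then show ?thesis using s x by (simp add: disparate_selection_iff)
    next
      assume "x \<notin> W" "x' \<notin> W"
      then show ?thesis using t x by (simp add: disparate_selection_iff)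
    next
      assume "x \<in> W" "x' \<notin> W"
      then show ?thesis using disp[OF s' t'] x by simp
    next
      assume "x \<notin> W" "x' \<in> W"
      then show ?thesis using disp[OF s' t', of x' x] x by (simp add: disparate_sym)
    qed
  qed
qed

lemma disparate_selection_through_point:
  assumes "(x, y) \<in> Sigma X F"
    and t: "disparate_selection E (X - {x}) (compl_map E Y X F {x} {(x, y)}) t"
  shows "\<exists>s. disparate_selection E X F s \<and> s x = y"
proof -
  have "disparate_selection E X F (\<lambda>z. if z \<in> {x} then y else t z)"
  proof (rule disparate_selection_union[where s = "\<lambda>_. y" and ?F1.0 = "\<lambda>_. {y}", OF _ t])
    show "disparate_selection E {x} (\<lambda>_. {y}) (\<lambda>_. y)"
      by (simp add: disparate_selection_iff)
    show "disparate E a b"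
      if "a \<in> {x} \<times> {y}" "b \<in> Sigma (X - {x}) (compl_map E Y X F {x} {(x, y)})" for a b
      using that unfolding Sigma_compl_map
      by (auto simp: compl_set_def disparate_sym[of E "(x, y)"])
  qed (use assms(1) in \<open>auto simp: Sigma_compl_map\<close>)
  then show ?thesis
    by (intro exI[of _ "\<lambda>z. if z \<in> {x} then y else t z"]) simp
qed

lemma disparate_selection_singleton:
  "F x \<noteq> {} \<Longrightarrow> \<exists>s. disparate_selection E {x} F s"
  by (auto simp: disparate_selection_iff intro: exI[of _ "\<lambda>_. SOME y. y \<in> F x"] some_in_eq[THEN iffD2])


section \<open>A disparate selection implies the generalized Hall condition\<close>

lemma casc_c_Suc: "casc_c W (Suc i) = casc_pre W (Suc i) - W (Suc i)"
  by (simp add: casc_pre_def)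

lemma cascade_le_pre:
  assumes "cascade X W k" "i < k"
  shows "W (Suc i) \<subseteq> casc_pre W (Suc i)"
proof -
  have "Suc i \<in> {1..k}" using assms by simp
  then have "W (Suc i) \<subseteq> W i \<or> W (Suc i) \<subseteq> casc_c W i"
    using assms(1) unfolding cascade_def by fastforce
  then show ?thesis by (auto simp: casc_pre_def)
qed

text \<open>The Hall collection given by a selection \<open>s\<close>.\<close>

definition graph_coll :: "('v \<Rightarrow> 'y) \<Rightarrow> 'v set \<Rightarrow> ('v \<times> 'y) set" where
  "graph_coll s V = (\<lambda>x. (x, s x)) ` V"

lemma card_graph_coll: "card (graph_coll s V) = card V"
  unfolding graph_coll_def by (rule card_image) (auto simp: inj_on_def)

lemma coll_union_graph_coll:
  assumes "\<And>V. V \<subseteq> D \<Longrightarrow> H V = graph_coll s V"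
  shows "coll_union D H = graph_coll s D"
proof -
  have "coll_union D H = (\<Union>V\<in>{V. V \<noteq> {} \<and> V \<subseteq> D}. graph_coll s V)"
    using assms by (auto simp: coll_union_def)
  also have "\<dots> = graph_coll s D"
    by (auto simp: graph_coll_def)
  finally show ?thesis .
qed

lemma coll_compl_graph_coll:
  assumes s: "disparate_selection E X F s" and "\<forall>x\<in>X. F x \<subseteq> Y"
    and D: "D \<subseteq> X" and H: "\<And>V. V \<subseteq> D \<Longrightarrow> H V = graph_coll s V"
    and W: "W \<subseteq> D" and V: "V \<subseteq> D - W"
  shows "coll_compl E Y D H W V = graph_coll s V"
proof -
  have "H (W \<union> V) = graph_coll s (W \<union> V)"
    using W V by (intro H) auto
  moreover have "coll_union W H = graph_coll s W"
    using W by (intro coll_union_graph_coll H) auto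
  moreover have "disparate E (x, s x) (x', s x')" if "x \<in> V" "x' \<in> W" for x x'
  proof -
    have "x \<in> X" "x' \<in> X" "x \<noteq> x'" using that D W V by auto
    with s show ?thesis by (simp add: disparate_selection_iff)
  qed
  moreover have "s x \<in> Y" if "x \<in> X" for x
    using that s assms(2) by (auto simp: disparate_selection_iff)
  ultimately show ?thesis
    using D W V by (auto simp: coll_compl_def graph_coll_def compl_set_def)
qed

lemma casc_coll_graph_coll:
  assumes s: "disparate_selection E X F s" and Y: "\<forall>x\<in>X. F x \<subseteq> Y"
    and casc: "cascade X W k"
  shows "i < k \<Longrightarrow> V \<subseteq> casc_pre W (Suc i) \<Longrightarrow> casc_coll E Y W (graph_coll s) i V = graph_coll s V"
proof (induction i arbitrary: V)
  case 0
  then show ?case by simp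
next
  case (Suc j)
  have W: "W (Suc j) \<subseteq> casc_pre W (Suc j)"
    using cascade_le_pre[OF casc] Suc.prems(1) by simp
  show ?case
  proof (cases "W (Suc (Suc j)) \<subseteq> W (Suc j)")
    case True
    then have "V \<subseteq> casc_pre W (Suc j)"
      using Suc.prems(2) W by (auto simp: casc_pre_def[of W "Suc (Suc j)"])
    with Suc.IH Suc.prems(1) True show ?thesis by (simp add: Let_def)
  next
    case False
    then have "V \<subseteq> casc_pre W (Suc j) - W (Suc j)"
      using Suc.prems(2) by (simp add: casc_pre_def[of W "Suc (Suc j)"] casc_c_Suc del: casc_c.simps)
    moreover have "casc_pre W (Suc j) \<subseteq> X"
      using Suc.prems(1) by (intro casc_pre_subset[OF casc]) simp
    ultimately have "coll_compl E Y (casc_pre W (Suc j)) (casc_coll E Y W (graph_coll s) j)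
        (W (Suc j)) V = graph_coll s V"
      using Suc.IH Suc.prems(1) W by (intro coll_compl_graph_coll[OF s Y]) auto
    with False show ?thesis by (simp add: Let_def)
  qed
qed

lemma set_distributed_graph_coll:
  assumes s: "disparate_selection E X F s"
    and D: "D \<subseteq> X" and H: "\<And>V. V \<subseteq> D \<Longrightarrow> H V = graph_coll s V" and W: "W \<subseteq> D"
    and fin: "finite X"
  shows "set_distributed E Y D H W"
  unfolding set_distributed_def
proof (intro allI impI)
  fix V assume "V \<noteq> {} \<and> V \<subseteq> D - W"
  then have V: "V \<subseteq> D - W" by simp
  have "H (W \<union> V) = graph_coll s (W \<union> V)"
    using W V by (intro H) auto
  moreover have "coll_union W H = graph_coll s W"
    using W by (intro coll_union_graph_coll H) auto
  moreover have "disparate E (x, s x) (x', s x')" if "x \<in> V" "x' \<in> W" for x x'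
  proof -
    have "x \<in> X" "x' \<in> X" "x \<noteq> x'" using that D W V by auto
    with s show ?thesis by (simp add: disparate_selection_iff)
  qed
  ultimately have
    "H (W \<union> V) \<inter> (W \<times> Y \<union> hull_set E Y D (coll_union W H) \<inter> (V \<times> Y)) \<subseteq> graph_coll s W"
    by (auto simp: graph_coll_def hull_set_def)
  then have "card (H (W \<union> V) \<inter> (W \<times> Y \<union> hull_set E Y D (coll_union W H) \<inter> (V \<times> Y)))
      \<le> card (graph_coll s W)"
    using W D fin by (intro card_mono) (auto simp: graph_coll_def dest: finite_subset)
  then show "card (H (W \<union> V) \<inter> (W \<times> Y \<union> hull_set E Y D (coll_union W H) \<inter> (V \<times> Y))) \<le> card W"
    by (simp add: card_graph_coll)
qed

lemma gen_hall_if_disparate_selection: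
  assumes fin: "finite X" and "X \<noteq> {}" and Y: "\<forall>x\<in>X. F x \<subseteq> Y"
    and s: "disparate_selection E X F s"
  shows "gen_hall E Y X F"
proof -
  have "hall_collection E X F (graph_coll s)"
    using s unfolding hall_collection_def collection_def card_graph_coll disparate_set_def
      disparate_selection_iff
    by (auto simp: graph_coll_def)
  moreover have "distributed P E Y X F (graph_coll s)" for P
    unfolding distributed_def
  proof (intro allI impI ballI)
    fix W k i
    assume prim: "primitive_critical_cascade P E Y X F (graph_coll s) W k" and i: "i \<in> {1..k}"
    then have casc: "cascade X W k" by (simp add: primitive_critical_cascade_def)
    from i obtain j where j: "i = Suc j" "j < k" by (cases i) auto
    show "set_distributed E Y (casc_pre W i) (casc_coll E Y W (graph_coll s) (i - 1)) (W i)"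
      using casc_pre_subset[OF casc i] casc_coll_graph_coll[OF s Y casc]
        cascade_le_pre[OF casc] j fin
      by (intro set_distributed_graph_coll[OF s]) auto
  qed
  moreover have "Sigma X F \<noteq> {}"
    using \<open>X \<noteq> {}\<close> s unfolding disparate_selection_iff by blast
  ultimately show ?thesis
    using fin \<open>X \<noteq> {}\<close> by (subst gen_hall.simps) auto
qed


section \<open>Splitting a distributed Hall collection along a critical set\<close>

text \<open>
  Prefixing \<open>W\<close> to a cascade \<open>V\<close> shifts the indices by one. The value \<open>V 0\<close> is the domain of the
  shorter cascade, which is \<open>X - W\<close> in the complementary case; in the longer cascade its place is
  taken by the member \<open>W\<close>.
\<close>

lemma casc_prefix:
  fixes V :: "nat \<Rightarrow> 'v set"
  assumes V0: "V 0 = D" and V1: "V 1 \<noteq> {}" "V 1 \<subseteq> D" and D: "D = W \<or> D = X - W"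
  defines "W' \<equiv> case_nat X (V(0 := W))"
  shows "casc_pre W' (Suc (Suc i)) = casc_pre V (Suc i) \<and>
         casc_c W' (Suc (Suc i)) = casc_c V (Suc i)"
proof (induction i)
  case 0
  have "casc_pre W' (Suc (Suc 0)) = casc_pre V (Suc 0)"
    using assms by (auto simp: W'_def casc_pre_def)
  moreover from this have "casc_c W' (Suc (Suc 0)) = casc_c V (Suc 0)"
    unfolding casc_c_Suc by (simp add: W'_def)
  ultimately show ?case ..
next
  case (Suc i)
  have "casc_pre W' (Suc (Suc (Suc i))) = casc_pre V (Suc (Suc i))"
    unfolding casc_pre_def using Suc by (simp add: W'_def del: casc_c.simps)
  moreover from this have "casc_c W' (Suc (Suc (Suc i))) = casc_c V (Suc (Suc i))"
    unfolding casc_c_Suc by (simp add: W'_def)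
  ultimately show ?case ..
qed

text \<open>
  A primitive critical cascade \<open>V\<close> in \<open>W\<close> or in \<open>X - W\<close> becomes one in \<open>X\<close> by prefixing the minimal
  critical set \<open>W\<close>: the collections and mappings derived after the step \<open>W\<close> are those derived along
  \<open>V\<close>. Hence being distributed is inherited by both parts.
\<close>

lemma distributed_descend:
  assumes dist: "distributed P E Y X F H" and crit: "minimal_gen_critical P E Y X F W"
    and cases: "D = W \<and> H1 = H \<and> F1 = coll_submap E Y X F H W \<or>
       D = X - W \<and> H1 = coll_compl E Y X H W \<and>
       F1 = compl_map E Y X F W (Sigma W (coll_submap E Y X F H W))"
  shows "distributed P E Y D F1 H1"
  unfolding distributed_def
proof (intro allI impI ballI)
  fix V k i
  assume prim: "primitive_critical_cascade P E Y D F1 H1 V k" and i: "i \<in> {1..k}"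
  then have casc: "cascade D V k" and k: "k \<ge> 1"
    by (auto simp: primitive_critical_cascade_def)
  have critV:
    "minimal_gen_critical P E Y (casc_pre V (Suc j)) (casc_map E Y V F1 H1 j) (V (Suc j))"
    if "j < k" for j
  proof -
    have "Suc j \<in> {1..k}" using that by simp
    with prim have "minimal_gen_critical P E Y (casc_pre V (Suc j))
        (casc_map E Y V F1 H1 (Suc j - 1)) (V (Suc j))"
      unfolding primitive_critical_cascade_def by blast
    then show ?thesis by simp
  qed
  have WX: "W \<subseteq> X" "W \<noteq> {}"
    using crit by (auto simp: minimal_gen_critical_def gen_critical_def)
  have V0: "V 0 = D" using casc by (simp add: cascade_def)
  have V1: "V 1 \<noteq> {}" "V 1 \<subseteq> D"
    using critV[of 0] k V0
    by (auto simp: minimal_gen_critical_def gen_critical_def casc_pre_def split: if_splits)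
  have D: "D = W \<or> D = X - W" using cases by blast
  define W' where "W' = case_nat X (V(0 := W))"
  have W': "W' 0 = X" "W' (Suc 0) = W" "\<And>j. W' (Suc (Suc j)) = V (Suc j)"
    by (simp_all add: W'_def)
  have pre: "casc_pre W' (Suc (Suc j)) = casc_pre V (Suc j)"
    and c: "casc_c W' (Suc (Suc j)) = casc_c V (Suc j)" for j
    using casc_prefix[OF V0 V1 D] unfolding W'_def by blast+
  have pre1: "casc_pre W' (Suc 0) = X"
    using WX by (simp add: casc_pre_def W')
  \<comment> \<open>As \<open>V 1\<close> is nonempty, it lies in \<open>W\<close> only in the first case.\<close>
  have first: "V (Suc 0) \<subseteq> W \<longleftrightarrow> D = W"
    using V1 D by auto
  have DW: "D = X - W \<Longrightarrow> D \<noteq> W" using WX by auto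
  have coll: "casc_coll E Y W' H (Suc j) = casc_coll E Y V H1 j" for j
  proof (induction j)
    case 0
    show ?case
      using cases first DW by (auto simp: W' pre1 Let_def)
  next
    case (Suc j)
    show ?case
      by (subst (1 2) casc_coll.simps) (simp only: Let_def W' pre Suc)
  qed
  have map: "casc_map E Y W' F H (Suc j) = casc_map E Y V F1 H1 j" for j
  proof (induction j)
    case 0
    show ?case
      using cases first DW by (auto simp: W' pre1 Let_def)
  next
    case (Suc j)
    show ?case
      by (subst (1 2) casc_map.simps) (simp only: Let_def W' pre Suc coll)
  qed
  have split: "\<exists>m. j = Suc (Suc m) \<and> m < k" if "j \<in> {1..Suc k}" "j \<noteq> Suc 0" for j
    using that by (cases j; cases "j - 1") auto
  have "primitive_critical_cascade P E Y X F H W' (Suc k)"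
    unfolding primitive_critical_cascade_def
  proof (intro conjI ballI)
    show "cascade X W' (Suc k)"
      unfolding cascade_def
    proof (intro conjI ballI)
      fix j assume j: "j \<in> {1..Suc k}"
      show "W' j \<subseteq> W' (j - 1) \<or> W' j \<subseteq> casc_c W' (j - 1)"
      proof (cases "j = Suc 0")
        case True
        then show ?thesis using WX by (simp add: W')
      next
        case False
        with j obtain m where m: "j = Suc (Suc m)" "m < k" using split by blast
        have "W' j \<subseteq> casc_pre W' j"
          using cascade_le_pre[OF casc m(2)] by (simp only: m(1) pre W')
        then show ?thesis by (auto simp: casc_pre_def split: if_splits)
      qed
    qed (simp_all add: W')
  next
    fix j assume j: "j \<in> {1..Suc k}"
    show "minimal_gen_critical P E Y (casc_pre W' j) (casc_map E Y W' F H (j - 1)) (W' j)"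
    proof (cases "j = Suc 0")
      case True
      then show ?thesis using crit by (simp add: W' pre1)
    next
      case False
      with j obtain m where m: "j = Suc (Suc m)" "m < k" using split by blast
      show ?thesis
        using critV[OF m(2)] by (simp only: m(1) diff_Suc_1 pre map W')
    qed
  qed
  then have "set_distributed E Y (casc_pre W' (Suc i)) (casc_coll E Y W' H (Suc i - 1)) (W' (Suc i))"
    using dist i unfolding distributed_def by (metis Suc_le_mono atLeastAtMost_iff le_add1 plus_1_eq_Suc)
  moreover obtain m where "i = Suc m" using i by (cases i) auto
  ultimately show "set_distributed E Y (casc_pre V i) (casc_coll E Y V H1 (i - 1)) (V i)"
    by (simp only: diff_Suc_1 pre coll W')
qed

lemma hall_collection_restrict:
  assumes H: "hall_collection E X F H" and Y: "\<forall>x\<in>X. F x \<subseteq> Y" and W: "W \<subseteq> X"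
  shows "hall_collection E W (coll_submap E Y X F H W) H"
proof -
  have "H V \<subseteq> Sigma V (coll_submap E Y X F H W)" if V: "V \<noteq> {}" "V \<subseteq> W" for V
  proof -
    have HV: "H V \<subseteq> Sigma V F"
      using H V W unfolding hall_collection_def collection_def by blast
    have "H V \<subseteq> compl_set E Y X (coll_union (X - W) (coll_compl E Y X H W))"
    proof
      fix a assume a: "a \<in> H V"
      with V have "a \<in> coll_union W H" by (auto simp: coll_union_def)
      then have "\<forall>b\<in>coll_union (X - W) (coll_compl E Y X H W). disparate E a b"
        by (auto simp: coll_union_def[of "X - W"] coll_compl_def compl_set_def disparate_sym[of E a])
      moreover have "a \<in> X \<times> Y" using a HV V W Y by fastforce
      ultimately show "a \<in> compl_set E Y X (coll_union (X - W) (coll_compl E Y X H W))"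
        by (simp add: compl_set_def)
    qed
    then have "H V \<subseteq> Sigma W (coll_submap E Y X F H W)"
      using HV V by (auto simp: Sigma_coll_submap)
    with HV show ?thesis by auto
  qed
  with H W show ?thesis
    unfolding hall_collection_def collection_def by (meson subset_trans)
qed

lemma hall_collection_compl:
  assumes H: "hall_collection E X F H" and Y: "\<forall>x\<in>X. F x \<subseteq> Y" and W: "W \<subseteq> X"
    and fin: "finite X" "finite Y" and dist: "set_distributed E Y X H W"
  shows "hall_collection E (X - W) (compl_map E Y X F W (Sigma W (coll_submap E Y X F H W)))
    (coll_compl E Y X H W)"
proof -
  let ?F = "compl_map E Y X F W (Sigma W (coll_submap E Y X F H W))"
  have "coll_compl E Y X H W V \<subseteq> Sigma V ?F \<and> disparate_set E (coll_compl E Y X H W V) \<and>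
      card V \<le> card (coll_compl E Y X H W V)" if V: "V \<noteq> {}" "V \<subseteq> X - W" for V
  proof (intro conjI)
    let ?C = "coll_compl E Y X H W V"
    let ?B = "W \<times> Y \<union> hull_set E Y X (coll_union W H) \<inter> (V \<times> Y)"
    have HV: "H (W \<union> V) \<subseteq> Sigma (W \<union> V) F" "disparate_set E (H (W \<union> V))"
        "card (W \<union> V) \<le> card (H (W \<union> V))"
    proof -
      have "W \<union> V \<noteq> {} \<and> W \<union> V \<subseteq> X" using V W by blast
      with H show "H (W \<union> V) \<subseteq> Sigma (W \<union> V) F" "disparate_set E (H (W \<union> V))"
          "card (W \<union> V) \<le> card (H (W \<union> V))"
        unfolding hall_collection_def collection_def by simp_all
    qed
    show "disparate_set E ?C"
      using HV(2) by (auto simp: coll_compl_def disparate_set_def)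
    show "?C \<subseteq> Sigma V ?F"
    proof
      fix a assume a: "a \<in> ?C"
      then have "a \<in> coll_union (X - W) (coll_compl E Y X H W)"
        using V by (auto simp: coll_union_def)
      then have "\<forall>b\<in>Sigma W (coll_submap E Y X F H W). disparate E a b"
        unfolding Sigma_coll_submap by (auto simp: compl_set_def disparate_sym[of E a])
      moreover have "a \<in> Sigma V F" "a \<in> X \<times> Y"
        using a HV(1) by (auto simp: coll_compl_def compl_set_def)
      ultimately have "a \<in> Sigma (X - W) ?F" "a \<in> Sigma V F"
        unfolding Sigma_compl_map using V by (auto simp: compl_set_def)
      then show "a \<in> Sigma V ?F" by auto
    qed
    have HXY: "H (W \<union> V) \<subseteq> X \<times> Y" using HV(1) V W Y by fastforce
    \<comment> \<open>Hull and complement partition \<open>X \<times> Y\<close>, so \<open>H\<^sub>W\<close> omits exactly the points bounded by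
      \<open>W\<close>-distributedness.\<close>
    have "H (W \<union> V) = (H (W \<union> V) \<inter> ?B) \<union> ?C"
      using HXY HV(1) V by (auto simp: coll_compl_def compl_set_def hull_set_def)
    then have "card (H (W \<union> V)) \<le> card (H (W \<union> V) \<inter> ?B) + card ?C"
      by (metis card_Un_le)
    also have "card (H (W \<union> V) \<inter> ?B) \<le> card W"
      using dist V by (auto simp: set_distributed_def)
    finally have "card (W \<union> V) \<le> card W + card ?C"
      using HV(3) by simp
    moreover have "card (W \<union> V) = card W + card V"
      using V W fin by (intro card_Un_disjoint) (auto intro: finite_subset)
    ultimately show "card V \<le> card ?C" by simp
  qed
  then show ?thesis by (simp add: hall_collection_def collection_def)
qed

lemma gen_hallI:
  assumes "finite X" "X \<noteq> {}" and H: "hall_collection E X F H"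
    and "distributed (\<lambda>W K. gen_hall E Y W K) E Y X F H"
  shows "gen_hall E Y X F"
proof -
  have "H X \<subseteq> Sigma X F" "card X \<le> card (H X)"
    using assms unfolding hall_collection_def collection_def by auto
  moreover have "card X > 0" using assms by (simp add: card_gt_0_iff)
  ultimately have "Sigma X F \<noteq> {}" by auto
  with assms show ?thesis by (subst gen_hall.simps) auto
qed


section \<open>The generalized Hall condition implies a disparate selection\<close>

lemma disparate_selection_if_gen_hall:
  assumes "finite Y" and "gen_hall E Y X F" and "\<forall>x\<in>X. F x \<subseteq> Y"
  shows "\<exists>s. disparate_selection E X F s"
  using assms(2,3)
proof (induction "card X" arbitrary: X F rule: less_induct)
  case less
  have fin: "finite X" and ne: "X \<noteq> {}"
    using less.prems(1) by (subst (asm) gen_hall.simps, force split: if_splits)+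
  show ?case
  proof (cases "card X = 1")
    case True
    then obtain x where "X = {x}" by (rule card_1_singletonE)
    moreover have "Sigma X F \<noteq> {}"
      using less.prems(1) True fin ne by (simp add: gen_hall.simps[of E Y X])
    ultimately show ?thesis using disparate_selection_singleton[of F x E] by auto
  next
    case False
    let ?P = "\<lambda>W K. gen_hall E Y W K"
    from False obtain H where H: "hall_collection E X F H" and dist: "distributed ?P E Y X F H"
      using less.prems(1) fin ne by (auto simp: gen_hall.simps[of E Y X])
    show ?thesis
    proof (cases "\<exists>W. gen_critical ?P E Y X F W")
      case no: False
      obtain x where x: "x \<in> X" using ne by blast
      have "H {x} \<subseteq> Sigma {x} F" "card {x} \<le> card (H {x})"
        using H x unfolding hall_collection_def collection_def by auto
      then have "H {x} \<noteq> {}" by auto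
      with \<open>H {x} \<subseteq> Sigma {x} F\<close> have "F x \<noteq> {}" by auto
      then obtain y where y: "y \<in> F x" by blast
      let ?G = "compl_map E Y X F {x} {(x, y)}"
      have "X - {x} \<noteq> {}" using False x by (auto simp: subset_singleton_iff)
      moreover have "\<not> gen_critical ?P E Y X F (X - {x})" using no by blast
      moreover have "(x, y) \<in> (X - (X - {x})) \<times> Y" using x y less.prems(2) by auto
      ultimately have "gen_hall E Y (X - {x}) ?G"
        unfolding gen_critical_def by (metis Diff_subset)
      moreover have "card (X - {x}) < card X"
        using fin x by (rule card_Diff1_less)
      moreover have "\<forall>z\<in>X - {x}. ?G z \<subseteq> Y"
        by (auto simp: compl_map_def map_of_graph_def compl_set_def)
      ultimately have "\<exists>t. disparate_selection E (X - {x}) ?G t"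
        by (intro less.hyps)
      then show ?thesis
        using disparate_selection_through_point x y by (metis SigmaI)
    next
      case True
      then have "{W. gen_critical ?P E Y X F W} \<noteq> {}" by blast
      moreover have "finite {W. gen_critical ?P E Y X F W}"
        by (rule finite_subset[OF _ finite_Pow_iff[THEN iffD2, OF fin]]) (auto simp: gen_critical_def)
      ultimately obtain W where crit: "minimal_gen_critical ?P E Y X F W"
        using finite_has_minimal[of "{W. gen_critical ?P E Y X F W}"]
        unfolding minimal_gen_critical_def by (metis mem_Collect_eq psubset_eq)
      then have W: "W \<noteq> {}" "W \<subset> X"
        by (auto simp: minimal_gen_critical_def gen_critical_def)
      \<comment> \<open>The one-term cascade \<open>(W)\<close>.\<close>
      have "primitive_critical_cascade ?P E Y X F H (case_nat X (\<lambda>_. W)) 1"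
        using W crit by (auto simp: primitive_critical_cascade_def cascade_def casc_pre_def)
      then have "set_distributed E Y (casc_pre (case_nat X (\<lambda>_. W)) 1)
          (casc_coll E Y (case_nat X (\<lambda>_. W)) H (1 - 1)) (case_nat X (\<lambda>_. W) 1)"
        using dist unfolding distributed_def by fastforce
      then have Wdist: "set_distributed E Y X H W"
        using psubset_imp_subset[OF W(2)] by (simp add: casc_pre_def)
      define F1 where "F1 = coll_submap E Y X F H W"
      define F2 where "F2 = compl_map E Y X F W (Sigma W F1)"
      have F1: "Sigma W F1 \<subseteq> Sigma W F" and F1Y: "\<forall>x\<in>W. F1 x \<subseteq> Y"
        unfolding F1_def by (auto simp: coll_submap_def map_of_graph_def compl_set_def)
      have F2: "Sigma (X - W) F2 = Sigma (X - W) F \<inter> compl_set E Y X (Sigma W F1)"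
        unfolding F2_def by (rule Sigma_compl_map)
      have F2Y: "\<forall>x\<in>X - W. F2 x \<subseteq> Y"
        by (auto simp: F2_def compl_map_def map_of_graph_def compl_set_def)
      have fW: "finite W" using finite_subset[OF psubset_imp_subset[OF W(2)] fin] .
      have "hall_collection E W F1 H"
        unfolding F1_def using W by (intro hall_collection_restrict[OF H less.prems(2)]) auto
      moreover have "distributed ?P E Y W F1 H"
        by (rule distributed_descend[OF dist crit]) (simp add: F1_def)
      ultimately have "gen_hall E Y W F1"
        using W fW by (intro gen_hallI)
      then obtain s where s: "disparate_selection E W F1 s"
        using less.hyps[OF psubset_card_mono[OF fin W(2)] _ F1Y] by blast
      have "hall_collection E (X - W) F2 (coll_compl E Y X H W)"
        unfolding F2_def F1_def using W
        by (intro hall_collection_compl[OF H less.prems(2) _ fin assms(1) Wdist]) auto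
      moreover have "distributed ?P E Y (X - W) F2 (coll_compl E Y X H W)"
        by (rule distributed_descend[OF dist crit]) (simp add: F1_def F2_def)
      ultimately have "gen_hall E Y (X - W) F2"
        using W fin by (intro gen_hallI) auto
      moreover have smaller: "card (X - W) < card X"
        using W fin by (intro psubset_card_mono) auto
      ultimately obtain t where t: "disparate_selection E (X - W) F2 t"
        using less.hyps[OF smaller _ F2Y] by blast
      have "disparate_selection E X F (\<lambda>x. if x \<in> W then s x else t x)"
      proof (rule disparate_selection_union[OF s t])
        show "disparate E a b" if "a \<in> Sigma W F1" "b \<in> Sigma (X - W) F2" for a b
          using that unfolding F2 by (auto simp: compl_set_def disparate_sym[of E a])
      qed (use W F1 F2 in auto)
      then show ?thesis by blast
    qed
  qed
qed


section \<open>Elimination and disparate selections\<close>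

text \<open>
  A disparate selection through \<open>(x, y)\<close> restricts to one of the complement mapping on \<open>W\<close>, which
  therefore satisfies the generalized Hall condition.
\<close>

lemma elim_no_disparate_selection:
  assumes fin: "finite X" and Y: "\<forall>x\<in>X. F x \<subseteq> Y" and W: "W \<noteq> {}" "W \<subseteq> X"
    and a: "(x, y) \<in> elim E Y X F W" and s: "disparate_selection E X F s"
  shows "s x \<noteq> y"
proof
  assume sx: "s x = y"
  have x: "x \<in> X - W" and no: "\<not> gen_hall E Y W (compl_map E Y X F {x} {(x, y)})"
    using a by (auto simp: elim_def)
  have "disparate_selection E W (compl_map E Y X F {x} {(x, y)}) s"
    unfolding disparate_selection_iff
  proof (intro conjI ballI impI)
    fix z assume z: "z \<in> W"
    then have "(z, s z) \<in> Sigma (X - {x}) F" "disparate E (z, s z) (x, y)"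
      using s sx x W by (auto simp: disparate_selection_iff)
    then show "s z \<in> compl_map E Y X F {x} {(x, y)} z"
      using Y by (auto simp: compl_map_def map_of_graph_def compl_set_def)
  next
    fix z z' assume "z \<in> W" "z' \<in> W" "z \<noteq> z'"
    then show "disparate E (z, s z) (z', s z')"
      using s W by (auto simp: disparate_selection_iff)
  qed
  moreover have "\<forall>z\<in>W. compl_map E Y X F {x} {(x, y)} z \<subseteq> Y"
    by (auto simp: compl_map_def map_of_graph_def compl_set_def)
  moreover have "finite W" using W fin by (auto intro: finite_subset)
  ultimately show False
    using no gen_hall_if_disparate_selection W by blast
qed

lemma disparate_selection_elim_iff:
  assumes "finite X" "\<forall>x\<in>X. F x \<subseteq> Y" "elimination_set E Y X F W"
    and F': "Sigma X F' = Sigma X F - elim E Y X F W"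
  shows "disparate_selection E X F' s \<longleftrightarrow> disparate_selection E X F s"
proof
  assume "disparate_selection E X F' s"
  moreover have "F' x \<subseteq> F x" if "x \<in> X" for x
    using F' that by blast
  ultimately show "disparate_selection E X F s"
    by (auto simp: disparate_selection_iff)
next
  assume s: "disparate_selection E X F s"
  have "s x \<in> F' x" if x: "x \<in> X" for x
  proof -
    have "(x, s x) \<notin> elim E Y X F W"
      using elim_no_disparate_selection[OF assms(1,2) _ _ _ s] assms(3)
      by (auto simp: elimination_set_def)
    moreover have "(x, s x) \<in> Sigma X F" using s x by (simp add: disparate_selection_iff)
    ultimately show ?thesis using F' by blast
  qed
  with s show "disparate_selection E X F' s" by (simp add: disparate_selection_iff)
qed

text \<open>Only the elimination sets \<open>X - {x}\<close> matter here.\<close>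

lemma disparate_selection_if_no_elimination_set:
  assumes "finite X" "finite Y" "\<forall>x\<in>X. F x \<subseteq> Y" and no: "\<nexists>W. elimination_set E Y X F W"
    and xy: "x \<in> X" "y \<in> F x"
  shows "\<exists>s. disparate_selection E X F s \<and> s x = y"
proof -
  have "\<exists>t. disparate_selection E (X - {x}) (compl_map E Y X F {x} {(x, y)}) t"
  proof (cases "X - {x} = {}")
    case True
    then show ?thesis by (simp only: disparate_selection_iff ball_empty simp_thms)
  next
    case False
    moreover have "\<not> elimination_set E Y X F (X - {x})" using no by blast
    ultimately have "elim E Y X F (X - {x}) = {}"
      by (simp add: elimination_set_def)
    then have "(x, y) \<notin> elim E Y X F (X - {x})" by simp
    then have "gen_hall E Y (X - {x}) (compl_map E Y X F {x} {(x, y)})"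
      using xy by (auto simp: elim_def)
    then show ?thesis
      by (rule disparate_selection_if_gen_hall[OF assms(2)])
        (auto simp: compl_map_def map_of_graph_def compl_set_def)
  qed
  with xy show ?thesis using disparate_selection_through_point by (metis SigmaI)
qed


section \<open>The course of the calculation\<close>

lemma cm1_step2_Suc:
  assumes "cm1_step2 E Y X Fs (Suc i)" "i \<noteq> 0"
  shows "cm1_step2 E Y X Fs i" "\<exists>W. elimination_set E Y X (Fs i) W"
  using assms by (auto elim: cm1_step2.cases)

lemma cm1_step2_pos: "cm1_step2 E Y X Fs i \<Longrightarrow> 0 < i"
  by (induction rule: cm1_step2.induct) auto

lemma cm1_step2_downward:
  assumes "cm1_step2 E Y X Fs n" "1 \<le> i" "i < n"
  shows "cm1_step2 E Y X Fs i \<and> (\<exists>W. elimination_set E Y X (Fs i) W) \<and> (\<forall>x\<in>X. Fs (Suc i) x \<noteq> {})"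
  using assms
proof (induction n rule: cm1_step2.induct)
  case (2 n)
  then show ?case by (cases "i = n") auto
qed simp

lemma cm1_invariant:
  assumes "finite X" "\<forall>x\<in>X. F x \<subseteq> Y" "cm1_execution E Y X F Fs Ws" "cm1_step2 E Y X Fs i"
  shows "(\<forall>x\<in>X. Fs i x \<subseteq> Y) \<and>
    (\<forall>s. disparate_selection E X (Fs i) s \<longleftrightarrow> disparate_selection E X F s)"
  using assms(4)
proof (induction rule: cm1_step2.induct)
  case 1
  then show ?case using assms by (simp add: cm1_execution_def)
next
  case (2 i)
  then have W: "elimination_set E Y X (Fs i) (Ws i)"
    and S: "Sigma X (Fs (Suc i)) = Sigma X (Fs i) - elim E Y X (Fs i) (Ws i)"
    using assms(3) by (auto simp: cm1_execution_def)
  have "\<forall>x\<in>X. Fs (Suc i) x \<subseteq> Fs i x" using S by blast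
  with 2 disparate_selection_elim_iff[OF assms(1) _ W S] show ?case by blast
qed

text \<open>Each round deletes at least one point of the graph; hence the calculation terminates.\<close>

lemma cm1_card_bound:
  assumes fin: "finite X" "finite Y" and Y: "\<forall>x\<in>X. F x \<subseteq> Y" and ex: "cm1_execution E Y X F Fs Ws"
    and "cm1_step2 E Y X Fs i"
  shows "i + card (Sigma X (Fs i)) \<le> 1 + card (Sigma X F)"
  using assms(5)
proof (induction rule: cm1_step2.induct)
  case 1
  then show ?case using ex by (simp add: cm1_execution_def)
next
  case (2 i)
  then have W: "elimination_set E Y X (Fs i) (Ws i)"
    and S: "Sigma X (Fs (Suc i)) = Sigma X (Fs i) - elim E Y X (Fs i) (Ws i)"
    using ex by (auto simp: cm1_execution_def)
  have "\<forall>x\<in>X. Fs i x \<subseteq> Y" using cm1_invariant[OF fin(1) Y ex 2(1)] by blast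
  then have "finite (Sigma X (Fs i))"
    using fin by (intro finite_SigmaI) (auto intro: finite_subset)
  moreover have "elim E Y X (Fs i) (Ws i) \<noteq> {}" "elim E Y X (Fs i) (Ws i) \<subseteq> Sigma X (Fs i)"
    using W by (auto simp: elimination_set_def elim_def)
  ultimately have "card (Sigma X (Fs (Suc i))) < card (Sigma X (Fs i))"
    unfolding S by (intro psubset_card_mono) auto
  with 2 show ?case by simp
qed

lemma cm1_outcome:
  assumes "finite X" "finite Y" "\<forall>x\<in>X. F x \<subseteq> Y" "cm1_execution E Y X F Fs Ws"
  obtains
    (step3) "cm1_stops_at_step3 E Y X Fs" "\<not> cm1_stops_at_step5 E Y X Fs"
      "cm1_step2 E Y X Fs (cm1_imax E Y X Fs)"
      "\<nexists>W. elimination_set E Y X (Fs (cm1_imax E Y X Fs)) W"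
  | (step5) i where "\<not> cm1_stops_at_step3 E Y X Fs" "cm1_stops_at_step5 E Y X Fs"
      "cm1_imax E Y X Fs = Suc i" "cm1_step2 E Y X Fs i" "\<exists>W. elimination_set E Y X (Fs i) W"
      "\<exists>x\<in>X. Fs (Suc i) x = {}"
proof -
  let ?S = "cm1_step2 E Y X Fs" and ?E = "\<lambda>i. \<exists>W. elimination_set E Y X (Fs i) W"
  \<comment> \<open>Step 2 is entered exactly for \<open>1, \<dots>, N\<close>, so \<open>N\<close> is the index at which the method stops.\<close>
  define N where "N = Max {i. ?S i}"
  have "{i. ?S i} \<subseteq> {..1 + card (Sigma X F)}"
    using cm1_card_bound[OF assms] by fastforce
  then have fin: "finite {i. ?S i}" by (rule finite_subset) simp
  have N: "?S N" "\<And>i. ?S i \<Longrightarrow> i \<le> N"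
    using Max_in[OF fin] Max_ge[OF fin] cm1_step2.intros(1)[of E Y X Fs] by (auto simp: N_def)
  have below: "?S i \<and> ?E i \<and> (\<forall>x\<in>X. Fs (Suc i) x \<noteq> {})" if "1 \<le> i" "i < N" for i
    using cm1_step2_downward[OF N(1) that] .
  have pos: "1 \<le> i" if "?S i" for i
    using cm1_step2_pos[OF that] by simp
  show ?thesis
  proof (cases "?E N")
    case False
    have "cm1_imax E Y X Fs = N"
      unfolding cm1_imax_def
    proof (rule Max_eqI)
      have "j \<le> N" if "cm1_occurs E Y X Fs j" for j
        using that N pos[OF N(1)] False unfolding cm1_occurs_def
        by (metis Suc_leI le_neq_implies_less)
      then show "finite {j. cm1_occurs E Y X Fs j}"
        and "\<And>j. j \<in> {j. cm1_occurs E Y X Fs j} \<Longrightarrow> j \<le> N"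
        by (auto intro: finite_subset[of _ "{..N}"])
      show "N \<in> {j. cm1_occurs E Y X Fs j}"
        using N(1) pos[OF N(1)] cm1_step2_Suc[of E Y X Fs "N - 1"]
        by (cases "N = 1") (auto simp: cm1_occurs_def intro!: exI[of _ "N - 1"])
    qed
    moreover have "cm1_stops_at_step3 E Y X Fs"
      using N(1) False by (auto simp: cm1_stops_at_step3_def)
    moreover have "\<not> cm1_stops_at_step5 E Y X Fs"
      unfolding cm1_stops_at_step5_def
      using below N(2) pos False by (metis le_neq_implies_less)
    ultimately show ?thesis using step3 N(1) False by simp
  next
    case True
    have empty: "\<exists>x\<in>X. Fs (Suc N) x = {}"
      using cm1_step2.intros(2)[OF N(1) True] N(2)[of "Suc N"] by auto
    have "cm1_imax E Y X Fs = Suc N"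
      unfolding cm1_imax_def
    proof (rule Max_eqI)
      have "j \<le> Suc N" if "cm1_occurs E Y X Fs j" for j
        using that N unfolding cm1_occurs_def by auto
      then show "finite {j. cm1_occurs E Y X Fs j}"
        and "\<And>j. j \<in> {j. cm1_occurs E Y X Fs j} \<Longrightarrow> j \<le> Suc N"
        by (auto intro: finite_subset[of _ "{..Suc N}"])
      show "Suc N \<in> {j. cm1_occurs E Y X Fs j}"
        using N(1) True by (auto simp: cm1_occurs_def)
    qed
    moreover have "cm1_stops_at_step5 E Y X Fs"
      using N(1) True empty by (auto simp: cm1_stops_at_step5_def)
    moreover have "\<not> cm1_stops_at_step3 E Y X Fs"
      unfolding cm1_stops_at_step3_def
      using below N(2) pos True by (metis le_neq_implies_less)
    ultimately show ?thesis using step5 N(1) True empty by simp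
  qed
qed

theorem theorem10p4:
  fixes X :: "'v set" and E :: "'v set set" and Y :: "'y set"
    and F :: "'v \<Rightarrow> 'y set" and Fs :: "nat \<Rightarrow> 'v \<Rightarrow> 'y set" and Ws :: "nat \<Rightarrow> 'v set"
  assumes "finite X" and "simple_graph X E" and "finite Y"
    and "\<forall>x\<in>X. F x \<subseteq> Y" and "Sigma X F \<noteq> {}"
    and "cm1_execution E Y X F Fs Ws"
  shows "((\<exists>s. disparate_selection E X F s) \<longleftrightarrow> \<not> cm1_stops_at_step5 E Y X Fs) \<and>
    ((\<exists>s. disparate_selection E X F s) \<longleftrightarrow> cm1_stops_at_step3 E Y X Fs) \<and>
    ((\<exists>s. disparate_selection E X F s) \<longleftrightarrow> disparate_map E X (Fs (cm1_imax E Y X Fs))) \<and>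
    ((\<exists>s. disparate_selection E X F s) \<longleftrightarrow>
       Sigma X (Fs (cm1_imax E Y X Fs)) \<noteq> {} \<and>
       (\<forall>x\<in>X. disparate_kernel E X F x = Fs (cm1_imax E Y X Fs) x))"
  using assms(1,3,4,6)
proof (cases rule: cm1_outcome)
  case step3
  let ?G = "Fs (cm1_imax E Y X Fs)"
  have GY: "\<forall>x\<in>X. ?G x \<subseteq> Y"
    and same: "disparate_selection E X ?G s \<longleftrightarrow> disparate_selection E X F s" for s
    using cm1_invariant[OF assms(1,4,6) step3(3)] by blast+
  have through: "\<exists>s. disparate_selection E X ?G s \<and> s x = y" if "x \<in> X" "y \<in> ?G x" for x y
    using disparate_selection_if_no_elimination_set[OF assms(1,3) GY step3(4) that] .
  have "Sigma X ?G \<noteq> {}"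
    using step3(3)
  proof cases
    case 1
    then show ?thesis using assms(5,6) by (simp add: cm1_execution_def)
  next
    case (2 i)
    then show ?thesis using assms(5) by auto
  qed
  moreover from this have "\<exists>s. disparate_selection E X F s"
    using through same by blast
  moreover have "disparate_kernel E X ?G x = ?G x" if "x \<in> X" for x
    using through that by (auto simp: disparate_kernel_def)
  moreover have "disparate_kernel E X F x = ?G x" if x: "x \<in> X" for x
  proof
    show "disparate_kernel E X F x \<subseteq> ?G x"
    proof
      fix y assume "y \<in> disparate_kernel E X F x"
      then obtain s where "disparate_selection E X ?G s" "s x = y"
        unfolding disparate_kernel_def same by blast
      with x show "y \<in> ?G x" by (auto simp: disparate_selection_iff)
    qed
    show "?G x \<subseteq> disparate_kernel E X F x"
      using through[OF x] x unfolding same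
      by (auto simp: disparate_kernel_def disparate_selection_iff)
  qed
  ultimately show ?thesis using step3(1,2) by (auto simp: disparate_map_def)
next
  case (step5 i)
  have W: "elimination_set E Y X (Fs i) (Ws i)"
    and S: "Sigma X (Fs (Suc i)) = Sigma X (Fs i) - elim E Y X (Fs i) (Ws i)"
    using assms(6) step5(4,5) by (auto simp: cm1_execution_def)
  have "disparate_selection E X (Fs (Suc i)) s \<longleftrightarrow> disparate_selection E X F s" for s
    using cm1_invariant[OF assms(1,4,6) step5(4)] disparate_selection_elim_iff[OF assms(1) _ W S]
    by blast
  moreover have none: "\<nexists>s. disparate_selection E X (Fs (Suc i)) s"
    using step5(6) by (auto simp: disparate_selection_iff)
  ultimately have "\<nexists>s. disparate_selection E X F s" by blast
  \<comment> \<open>A nonempty graph equal to a disparate kernel would yield a disparate selection.\<close>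
  then show ?thesis
    using step5(1-3) none by (force simp: disparate_map_def disparate_kernel_def)
qed

end
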